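(* Let $1\le p<n$ and $q=n-p$. A subset $M\subset \widetilde{AG}_p(n)$ is the set of fibers of a $(p,n)$-fibration if and only if there is a $q$-dimensional, connected, contractible submanifold $U\subset \tilde G_p(n)$ and a (continuous) section $v$ of the bundle $\xi_U$ such that $M$ is the graph of $v$, i.e. $M=\{(u,v(u)) : u\in U\}$, and the following two properties hold: (1) for all distinct $u_1,u_2\in U$, $\dim\big(\operatorname{Span}\{u_1,u_2,v(u_1)-v(u_2)\}\big)=2p+1$; (2) if $\{u_k\}\subset U$ is a sequence converging to a point $u\in\partial U$, then $|v(u_k)|\to\infty$.
   Context: $\tilde G_p(n)$ is the Grassmann manifold of oriented $p$-dimensional linear subspaces of $\mathbb R^n$, and $\widetilde{AG}_p(n)$ is the manifold of oriented $p$-dimensional affine subspaces of $\mathbb R^n$. An element $P\in\widetilde{AG}_p(n)$ is identified with the pair $(u,v)$, where $v\in\mathbb R^n$ is the point of $P$ closest to the origin and $u\in\tilde G_p(n)$ is the parallel translate of $P$ through the origin (so $v\perp u$). A $(p,n)$-fibration is a continuous fibration of $\mathbb R^n$ by pairwise skew oriented affine $p$-planes (the fibers): through every point of $\mathbb R^n$ passes exactly one fiber, the map $V:\mathbb R^n\to\tilde G_p(n)$ sending a point to the oriented direction of the fiber through it is continuous, and any two distinct fibers are skew, meaning they do not intersect and contain no common parallel direction (their direction subspaces intersect only in $0$). For $U\subset\tilde G_p(n)$, $\xi_U$ is the $\mathbb R^q$-bundle over $U$ whose fiber over $u\in U$ is the orthogonal complement $u^\perp\subset\mathbb R^n$. Submanifolds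 are topological (embedded) submanifolds. $\partial U$ denotes $\overline U\setminus U$, with closure taken in $\tilde G_p(n)$. *)

theory Defs
  imports "HOL-Analysis.Analysis"
begin

definition quotient_topology :: "'a topology \<Rightarrow> ('a \<Rightarrow> 'b) \<Rightarrow> 'b topology" where
  "quotient_topology X f =
     topology (\<lambda>S. S \<subseteq> f ` topspace X \<and> openin X {x \<in> topspace X. f x \<in> S})"

lemma openin_quotient_topology:
  "openin (quotient_topology X f) S \<longleftrightarrow>
     S \<subseteq> f ` topspace X \<and> openin X {x \<in> topspace X. f x \<in> S}"
proof -
  let ?P = "\<lambda>S. S \<subseteq> f ` topspace X \<and> openin X {x \<in> topspace X. f x \<in> S}"
  have "istopology ?P"
    unfolding istopology_def
  proof (intro conjI allI impI)
    fix S T assume S: "?P S" and T: "?P T"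
    show "S \<inter> T \<subseteq> f ` topspace X" using S by blast
    have "{x \<in> topspace X. f x \<in> S \<inter> T} =
            {x \<in> topspace X. f x \<in> S} \<inter> {x \<in> topspace X. f x \<in> T}" by blast
    then show "openin X {x \<in> topspace X. f x \<in> S \<inter> T}" using S T by auto
  next
    fix K assume K: "\<forall>S\<in>K. ?P S"
    show "\<Union>K \<subseteq> f ` topspace X" using K by blast
    have "{x \<in> topspace X. f x \<in> \<Union>K} = (\<Union>S\<in>K. {x \<in> topspace X. f x \<in> S})" by blast
    then show "openin X {x \<in> topspace X. f x \<in> \<Union>K}" using K by auto
  qed
  then show ?thesis
    unfolding quotient_topology_def by (simp add: topology_inverse')
qed

lemma topspace_quotient_topology: "topspace (quotient_topology X f) = f ` topspace X"
proof
  show "topspace (quotient_topology X f) \<subseteq> f ` topspace X"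
    using openin_topspace[of "quotient_topology X f"] unfolding openin_quotient_topology by blast
  have "{x \<in> topspace X. f x \<in> f ` topspace X} = topspace X" by blast
  then have "openin (quotient_topology X f) (f ` topspace X)"
    by (simp add: openin_quotient_topology)
  then show "f ` topspace X \<subseteq> topspace (quotient_topology X f)"
    by (rule openin_subset)
qed

lemma quotient_map_quotient_topology: "quotient_map X (quotient_topology X f) f"
  unfolding quotient_map_def
  by (auto simp: topspace_quotient_topology openin_quotient_topology)

(* The rows of a matrix in real^'n^'p form a p-tuple of vectors of R^n, with p = CARD('p) and
   n = CARD('n).  An oriented p-dimensional linear subspace is represented by the set of all its
   positively oriented orthonormal bases; two orthonormal bases span the same oriented subspace
   iff they differ by left multiplication with an element of SO(p). *)

definition stiefel :: "(real^'n^'p) set" where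
  "stiefel = {A. \<forall>i j. A $ i \<bullet> A $ j = (if i = j then 1 else 0)}"

definition oriented_span :: "real^'n^'p \<Rightarrow> (real^'n^'p) set" where
  "oriented_span A = {R ** A | R. rotation_matrix R}"

definition oriented_grassmannian :: "(real^'n^'p) set topology" where
  "oriented_grassmannian = quotient_topology (top_of_set stiefel) oriented_span"

definition plane_of :: "(real^'n^'p) set \<Rightarrow> (real^'n) set" where
  "plane_of u = span (\<Union>A\<in>u. rows A)"

(* (u, v) stands for the oriented affine plane through v with oriented direction u; v, being
   orthogonal to u, is its point closest to the origin. *)

definition affine_oriented_grassmannian :: "((real^'n^'p) set \<times> (real^'n)) set" where
  "affine_oriented_grassmannian =
     {(u, v). u \<in> topspace oriented_grassmannian \<and> v \<in> (plane_of u)\<^sup>\<bottom>}"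

definition points_of :: "(real^'n^'p) set \<times> (real^'n) \<Rightarrow> (real^'n) set" where
  "points_of P = {snd P + x | x. x \<in> plane_of (fst P)}"

definition skew ::
  "(real^'n^'p) set \<times> (real^'n) \<Rightarrow> (real^'n^'p) set \<times> (real^'n) \<Rightarrow> bool" where
  "skew P Q \<longleftrightarrow>
     points_of P \<inter> points_of Q = {} \<and> plane_of (fst P) \<inter> plane_of (fst Q) = {0}"

definition fiber_through ::
  "((real^'n^'p) set \<times> (real^'n)) set \<Rightarrow> real^'n \<Rightarrow> (real^'n^'p) set \<times> (real^'n)" where
  "fiber_through M x = (THE P. P \<in> M \<and> x \<in> points_of P)"

definition is_fibration :: "((real^'n^'p) set \<times> (real^'n)) set \<Rightarrow> bool" where
  "is_fibration M \<longleftrightarrow>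
     M \<subseteq> affine_oriented_grassmannian \<and>
     (\<forall>x. \<exists>!P. P \<in> M \<and> x \<in> points_of P) \<and>
     continuous_map euclidean oriented_grassmannian (\<lambda>x. fst (fiber_through M x)) \<and>
     (\<forall>P\<in>M. \<forall>Q\<in>M. P \<noteq> Q \<longrightarrow> skew P Q)"

definition topological_manifold :: "nat \<Rightarrow> 'a topology \<Rightarrow> bool" where
  "topological_manifold q X \<longleftrightarrow>
     Hausdorff_space X \<and> second_countable X \<and>
     (\<forall>x\<in>topspace X. \<exists>N W. openin X N \<and> x \<in> N \<and> openin (Euclidean_space q) W \<and>
        subtopology X N homeomorphic_space subtopology (Euclidean_space q) W)"

definition topological_submanifold :: "nat \<Rightarrow> 'a topology \<Rightarrow> 'a set \<Rightarrow> bool" where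
  "topological_submanifold q X U \<longleftrightarrow>
     U \<subseteq> topspace X \<and> topological_manifold q (subtopology X U)"

definition xi_bundle ::
  "(real^'n^'p) set set \<Rightarrow> ((real^'n^'p) set \<times> (real^'n)) topology" where
  "xi_bundle U =
     subtopology (prod_topology oriented_grassmannian euclidean)
       {(u, w). u \<in> U \<and> w \<in> (plane_of u)\<^sup>\<bottom>}"

definition xi_section ::
  "(real^'n^'p) set set \<Rightarrow> ((real^'n^'p) set \<Rightarrow> real^'n) \<Rightarrow> bool" where
  "xi_section U v \<longleftrightarrow>
     continuous_map (subtopology oriented_grassmannian U) (xi_bundle U) (\<lambda>u. (u, v u))"

end

(* Both directions rest on invariance of domain.  Write P_u for the orthogonal projection onto u.

   Fibration to section: let V x be the direction of the fiber through x.  Fix x and choose t near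
   0 in the orthogonal complement of V x and y in V x, y nonzero.  As distinct fibers share no
   direction, t + y |-> P_{V(x + t)} y is injective, hence open; a direction w in the image U of V
   that is close to V(x + t) then meets the plane of some V(x + t') with t' near t in a nonzero
   vector, hence equals it.  So V is open onto U, the slices x + t are charts of U, the foot of a
   fiber depends continuously on its direction, and U is a retract of R^n.

   Section to fibration: in a chart phi of U the map (t, y) |-> v(phi t) + P_{phi t} y is injective
   by skewness, hence open.  So the fibers fill an open set, on which the direction is continuous;
   the set is closed by properness of v and compactness of the Stiefel manifold, hence all of R^n. *)
theory Submission
  imports Defs "HOL-Homology.Homology"
begin

text \<open>This rule would turn \<open>transpose A *v x\<close> into \<open>x v* A\<close>; planes
  and projections are described below through the first form.\<close>

declare transpose_matrix_vector [simp del]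

section \<open>Continuity of matrix operations and the Frobenius norm\<close>

lemma continuous_on_matrix_mult [continuous_intros]:
  fixes f :: "'a::topological_space \<Rightarrow> real^'n^'m" and g :: "'a \<Rightarrow> real^'k^'n"
  assumes "continuous_on S f" "continuous_on S g"
  shows "continuous_on S (\<lambda>x. f x ** g x)"
  unfolding matrix_matrix_mult_def by (intro continuous_intros assms)

lemma continuous_on_matrix_vector_mult [continuous_intros]:
  fixes f :: "'a::topological_space \<Rightarrow> real^'n^'m" and g :: "'a \<Rightarrow> real^'n"
  assumes "continuous_on S f" "continuous_on S g"
  shows "continuous_on S (\<lambda>x. f x *v g x)"
  unfolding matrix_vector_mult_def by (intro continuous_intros assms)

lemma continuous_on_transpose [continuous_intros]:
  fixes f :: "'a::topological_space \<Rightarrow> real^'n^'m"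
  assumes "continuous_on S f"
  shows "continuous_on S (\<lambda>x. transpose (f x))"
  unfolding transpose_def by (intro continuous_intros assms)

text \<open>Cauchy-Schwarz row by row. The norm on matrices is the Frobenius norm, which dominates
  the operator norm.\<close>

lemma norm_matrix_vector_mult_le:
  fixes A :: "real^'n^'m"
  shows "norm (A *v x) \<le> norm A * norm x"
proof -
  have "norm (A *v x) \<le> L2_set (\<lambda>i. norm (A $ i) * norm x) UNIV"
    unfolding norm_vec_def[of "A *v x"]
  proof (rule L2_set_mono)
    show "norm ((A *v x) $ i) \<le> norm (A $ i) * norm x" for i
      using Cauchy_Schwarz_ineq2[of "A $ i" x]
      by (simp add: matrix_vector_mul_component)
  qed simp
  also have "\<dots> = norm A * norm x"
    by (simp add: norm_vec_def[of A] L2_set_left_distrib)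
  finally show ?thesis .
qed

lemma norm_transpose:
  fixes A :: "real^'n^'m"
  shows "norm (transpose A) = norm A"
proof -
  have "transpose A \<bullet> transpose A = A \<bullet> A"
    unfolding inner_vec_def transpose_def by (simp, rule sum.swap)
  then show ?thesis
    by (simp add: norm_eq_sqrt_inner)
qed

text \<open>An orthogonal \<open>R\<close> acts isometrically on each column of \<open>A\<close>;
  hence the detour through the transpose, whose rows are these columns.\<close>

lemma norm_orthogonal_matrix_mult:
  fixes A :: "real^'n^'m"
  assumes "orthogonal_matrix R"
  shows "norm (R ** A) = norm A"
proof -
  have "norm (R *v x) = norm x" for x
    using assms orthogonal_transformation_matrix[of "(*v) R"]
    by (simp add: orthogonal_transformation_norm)
  moreover have "transpose (R ** A) $ i = R *v (transpose A $ i)" for i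
    by (simp add: transpose_def matrix_matrix_mult_def matrix_vector_mult_def vec_eq_iff)
  ultimately have "norm (transpose (R ** A)) = norm (transpose A)"
    by (simp add: norm_vec_def[of "transpose (R ** A)"] norm_vec_def[of "transpose A"])
  then show ?thesis
    by (simp add: norm_transpose)
qed

lemma matrix_diff_ldistrib:
  fixes A :: "real^'n^'m" and B C :: "real^'k^'n"
  shows "A ** (B - C) = A ** B - A ** C"
  by (simp add: matrix_matrix_mult_def vec_eq_iff sum_subtractf right_diff_distrib)

subsection \<open>The oriented Grassmannian\<close>

lemma stiefel_iff: "A \<in> stiefel \<longleftrightarrow> A ** transpose A = mat 1"
  by (simp add: stiefel_def vec_eq_iff matrix_matrix_mult_def transpose_def mat_def inner_vec_def)

text \<open>Closed as the preimage of a point, bounded because the rows are unit vectors. This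
  compactness later supplies convergent subsequences of directions.\<close>

lemma compact_stiefel: "compact (stiefel :: (real^'n^'p) set)"
proof -
  have "stiefel = (\<lambda>A :: real^'n^'p. A ** transpose A) -` {mat 1}"
    by (auto simp: stiefel_iff)
  moreover have "continuous_on UNIV (\<lambda>A :: real^'n^'p. A ** transpose A)"
    by (intro continuous_intros)
  ultimately have "closed (stiefel :: (real^'n^'p) set)"
    by (metis closed_vimage closed_singleton)
  moreover have "norm A \<le> CARD('p)" if "A \<in> stiefel" for A :: "real^'n^'p"
  proof -
    have "norm (A $ i) = 1" for i
      using that by (simp add: stiefel_def norm_eq_sqrt_inner)
    then show ?thesis
      using L2_set_le_sum[of UNIV "\<lambda>i. norm (A $ i)"] by (simp add: norm_vec_def)
  qed
  ultimately show ?thesis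
    by (meson boundedI compact_eq_bounded_closed)
qed

section \<open>The action of SO(p) on orthonormal frames and its orbit space\<close>

lemma rotation_matrix_mult:
  fixes Q R :: "real^'n^'n"
  shows "rotation_matrix Q \<Longrightarrow> rotation_matrix R \<Longrightarrow> rotation_matrix (Q ** R)"
  by (simp add: rotation_matrix_def orthogonal_matrix_mul det_mul)

lemma rotation_matrix_transpose: "rotation_matrix R \<Longrightarrow> rotation_matrix (transpose R)"
  by (simp add: rotation_matrix_def orthogonal_matrix_transpose)

lemma rotation_matrix_left_inverse: "rotation_matrix R \<Longrightarrow> transpose R ** R = mat 1"
  by (simp add: rotation_matrix_def orthogonal_matrix_def)

lemma rotation_matrix_mat_1: "rotation_matrix (mat 1)"
  by (simp add: rotation_matrix_def orthogonal_matrix_id)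

lemma rotation_mult_mem_stiefel:
  assumes "rotation_matrix R" "A \<in> stiefel"
  shows "R ** A \<in> stiefel"
proof -
  have "(R ** A) ** transpose (R ** A) = R ** (A ** transpose A) ** transpose R"
    by (simp add: matrix_transpose_mul matrix_mul_assoc)
  then show ?thesis
    using assms by (simp add: stiefel_iff rotation_matrix_def orthogonal_matrix_def)
qed

lemma self_mem_oriented_span: "A \<in> oriented_span A"
  unfolding oriented_span_def mem_Collect_eq
  by (rule exI[of _ "mat 1"]) (simp add: rotation_matrix_mat_1)

lemma oriented_span_rotation:
  assumes "rotation_matrix R"
  shows "oriented_span (R ** A) = oriented_span A"
proof -
  have *: "Q ** A = (Q ** transpose R) ** (R ** A)" for Q
    using rotation_matrix_left_inverse[OF assms] by (metis matrix_mul_assoc matrix_mul_rid)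
  show ?thesis
  proof
    show "oriented_span (R ** A) \<subseteq> oriented_span A"
      unfolding oriented_span_def using rotation_matrix_mult[OF _ assms]
      by (auto simp: matrix_mul_assoc)
    show "oriented_span A \<subseteq> oriented_span (R ** A)"
      unfolding oriented_span_def
      using rotation_matrix_mult[OF _ rotation_matrix_transpose[OF assms]] * by blast
  qed
qed

lemma oriented_span_eq_iff:
  "oriented_span A = oriented_span B \<longleftrightarrow> (\<exists>R. rotation_matrix R \<and> B = R ** A)"
proof
  assume "oriented_span A = oriented_span B"
  then show "\<exists>R. rotation_matrix R \<and> B = R ** A"
    using self_mem_oriented_span[of B] by (auto simp: oriented_span_def)
qed (auto simp: oriented_span_rotation)

lemma topspace_oriented_grassmannian:
  "topspace oriented_grassmannian = oriented_span ` stiefel"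
  by (simp add: oriented_grassmannian_def topspace_quotient_topology)

lemma quotient_map_oriented_span:
  "quotient_map (top_of_set stiefel) oriented_grassmannian oriented_span"
  unfolding oriented_grassmannian_def by (rule quotient_map_quotient_topology)

text \<open>The saturation of an open set \<open>S\<close> is the union of its preimages under all
  rotations, and each of these is open because a rotation acts continuously on
  \<open>stiefel\<close>.\<close>

lemma open_map_oriented_span:
  "open_map (top_of_set (stiefel :: (real^'n^'p) set)) oriented_grassmannian oriented_span"
  unfolding open_map_def
proof (intro allI impI)
  fix S :: "(real^'n^'p) set" assume S: "openin (top_of_set stiefel) S"
  have sub: "S \<subseteq> stiefel"
    using openin_imp_subset[OF S] .
  have "openin (top_of_set stiefel) {A \<in> stiefel. R ** A \<in> S}"
    if "rotation_matrix R" for R :: "real^'p^'p"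
  proof -
    have "continuous_map (top_of_set stiefel) (top_of_set stiefel) (\<lambda>A :: real^'n^'p. R ** A)"
      using that by (auto simp: rotation_mult_mem_stiefel intro!: continuous_intros)
    from openin_continuous_map_preimage[OF this S] show ?thesis by simp
  qed
  then have "openin (top_of_set stiefel)
      (\<Union>R\<in>Collect rotation_matrix. {A \<in> stiefel. R ** A \<in> S})"
    by blast
  also have "(\<Union>R\<in>Collect rotation_matrix. {A \<in> stiefel. R ** A \<in> S})
      = {A \<in> topspace (top_of_set stiefel). oriented_span A \<in> oriented_span ` S}"
    using sub by (auto simp: image_iff oriented_span_eq_iff)
  finally show "openin oriented_grassmannian (oriented_span ` S)"
    using sub by (simp add: oriented_grassmannian_def openin_quotient_topology image_mono)
qed

lemma second_countable_euclidean:
  "second_countable (euclidean :: 'a::second_countable_topology topology)"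
proof -
  obtain B :: "'a set set" where B: "countable B" "topological_basis B"
    using ex_countable_basis by auto
  then have "\<exists>V\<in>B. x \<in> V \<and> V \<subseteq> S" if "open S" "x \<in> S" for S x
    using that topological_basisE[OF B(2)] by (metis (no_types))
  moreover have "\<forall>V\<in>B. open V"
    using topological_basis_open[OF B(2)] by simp
  ultimately show ?thesis
    using B(1) by (auto simp: second_countable_def intro!: exI[of _ B])
qed

lemma second_countable_oriented_grassmannian:
  "second_countable (oriented_grassmannian :: (real^'n^'p) set topology)"
proof (rule second_countable_open_map_image)
  show "continuous_map (top_of_set stiefel) (oriented_grassmannian :: (real^'n^'p) set topology)
      oriented_span"
    by (rule quotient_imp_continuous_map[OF quotient_map_oriented_span])
  show "second_countable (top_of_set (stiefel :: (real^'n^'p) set))"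
    by (rule second_countable_subtopology[OF second_countable_euclidean])
  show "open_map (top_of_set stiefel) (oriented_grassmannian :: (real^'n^'p) set topology)
      oriented_span"
    by (rule open_map_oriented_span)
  show "oriented_span ` topspace (top_of_set stiefel) =
      topspace (oriented_grassmannian :: (real^'n^'p) set topology)"
    unfolding topspace_oriented_grassmannian by simp
qed

text \<open>Rotations act by isometries, so disjoint compact orbits have disjoint metric neighbourhoods
  that are unions of orbits.\<close>

lemma Hausdorff_oriented_grassmannian:
  "Hausdorff_space (oriented_grassmannian :: (real^'n^'p) set topology)"
  unfolding Hausdorff_space_def
proof (intro allI impI)
  fix u w :: "(real^'n^'p) set"
  assume uw: "u \<in> topspace oriented_grassmannian \<and> w \<in> topspace oriented_grassmannian \<and> u \<noteq> w"
  then obtain A B where A: "A \<in> stiefel" "u = oriented_span A"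
    and B: "B \<in> stiefel" "w = oriented_span B"
    by (auto simp: topspace_oriented_grassmannian)
  let ?SO = "Collect rotation_matrix :: (real^'p^'p) set"
  have "closed ?SO"
  proof -
    \<comment> \<open>A square matrix with orthonormal rows is orthogonal, so SO(p) is a closed part
      of the compact Stiefel manifold of square frames.\<close>
    have "?SO = (stiefel :: (real^'p^'p) set) \<inter> det -` {1}"
      by (auto simp: rotation_matrix_def stiefel_iff orthogonal_matrix matrix_left_right_inverse)
    moreover have "continuous_on UNIV (det :: real^'p^'p \<Rightarrow> real)"
      unfolding det_def by (intro continuous_intros)
    then have "closed (det -` {1} :: (real^'p^'p) set)"
      by (simp add: closed_vimage)
    ultimately show ?thesis
      by (simp add: closed_Int compact_imp_closed compact_stiefel)
  qed
  moreover have "?SO \<subseteq> stiefel"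
    by (auto simp: rotation_matrix_def stiefel_iff orthogonal_matrix_def)
  ultimately have "compact ?SO"
    using compact_stiefel by (metis compact_Int_closed inf.absorb_iff2)
  then have "compact ((\<lambda>R. R ** A) ` ?SO)"
    by (intro compact_continuous_image continuous_intros)
  moreover have "oriented_span A = (\<lambda>R. R ** A) ` ?SO"
    by (auto simp: oriented_span_def)
  ultimately have "closed (oriented_span A)"
    by (simp add: compact_imp_closed)
  moreover have "B \<notin> oriented_span A"
  proof
    assume "B \<in> oriented_span A"
    then obtain R where "rotation_matrix R" "B = R ** A"
      by (auto simp: oriented_span_def)
    then show False
      using uw A B by (simp add: oriented_span_rotation)
  qed
  ultimately obtain d where d: "d > 0" "\<And>C. C \<in> oriented_span A \<Longrightarrow> d \<le> dist B C"
    using separate_point_closed[of "oriented_span A" B] by auto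
  let ?N = "\<lambda>C. oriented_span ` (stiefel \<inter> ball C (d/2))"
  have "openin oriented_grassmannian (?N C)" for C
    using open_map_oriented_span[unfolded open_map_def] by (metis open_ball openin_open)
  moreover have "u \<in> ?N A" "w \<in> ?N B"
    using A B d by auto
  moreover have "disjnt (?N A) (?N B)"
  proof -
    have False if X: "dist A X < d/2" and Y: "dist B Y < d/2" and eq: "oriented_span X = oriented_span Y"
      for X Y :: "real^'n^'p"
    proof -
      obtain R where R: "rotation_matrix R" "Y = R ** X"
        using eq oriented_span_eq_iff by blast
      \<comment> \<open>The rotation taking \<open>X\<close> to \<open>Y\<close> takes
        \<open>A\<close> to a point of its orbit within \<open>d/2\<close> of \<open>Y\<close>,
        hence within \<open>d\<close> of \<open>B\<close>, against the choice of
        \<open>d\<close>.\<close>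
      have "dist (R ** A) (R ** X) = dist A X"
        using R norm_orthogonal_matrix_mult[of R "A - X"]
        by (simp add: dist_norm rotation_matrix_def matrix_diff_ldistrib)
      moreover have "R ** A \<in> oriented_span A"
        using R by (auto simp: oriented_span_def)
      ultimately show False
        using d(2)[of "R ** A"] X Y R dist_triangle_half_r[of "R ** X" B d "R ** A"]
        by (fastforce simp: dist_commute)
    qed
    then show ?thesis
      by (force simp: disjnt_iff)
  qed
  ultimately show "\<exists>U V. openin oriented_grassmannian U \<and> openin oriented_grassmannian V \<and>
      u \<in> U \<and> w \<in> V \<and> disjnt U V"
    by blast
qed

lemma limitin_oriented_span:
  assumes "(f \<longlongrightarrow> A) F" "\<forall>k. f k \<in> stiefel" "A \<in> stiefel"
  shows "limitin oriented_grassmannian (\<lambda>k. oriented_span (f k)) (oriented_span A) F"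
proof -
  have "limitin (top_of_set stiefel) f A F"
    using assms by (simp add: limitin_subtopology)
  from continuous_map_limit[OF quotient_imp_continuous_map[OF quotient_map_oriented_span] this]
  show ?thesis by (simp add: o_def)
qed

subsection \<open>Orthogonal projections\<close>

text \<open>For an orthonormal frame \<open>A\<close> the matrix \<open>transpose A ** A\<close> is
  the orthogonal projection onto the span of the rows. The choice of \<open>A\<close> in
  \<open>u\<close> is immaterial: two choices differ by a rotation \<open>R\<close>, and
  \<open>transpose R ** R\<close> cancels.\<close>

definition plane_proj :: "(real^'n^'p) set \<Rightarrow> real^'n^'n" where
  "plane_proj u = transpose (SOME A. A \<in> u) ** (SOME A. A \<in> u)"

lemma plane_proj_oriented_span: "plane_proj (oriented_span A) = transpose A ** A"
proof -
  have "(SOME B. B \<in> oriented_span A) \<in> oriented_span A"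
    using self_mem_oriented_span by (metis someI)
  then obtain R where R: "rotation_matrix R" "(SOME B. B \<in> oriented_span A) = R ** A"
    by (auto simp: oriented_span_def)
  then have "plane_proj (oriented_span A) = transpose A ** (transpose R ** R) ** A"
    by (simp add: plane_proj_def matrix_transpose_mul matrix_mul_assoc)
  then show ?thesis
    using R by (simp add: rotation_matrix_left_inverse)
qed

text \<open>Continuity is checked on frames and descends along the quotient map. Through this map,
  convergence of directions becomes convergence of matrices.\<close>

lemma continuous_map_plane_proj: "continuous_map oriented_grassmannian euclidean plane_proj"
proof (rule continuous_compose_quotient_map[OF quotient_map_oriented_span])
  show "continuous_map (top_of_set stiefel) euclidean (plane_proj \<circ> oriented_span)"
    by (simp add: o_def plane_proj_oriented_span continuous_intros)
qed

text \<open>\<open>transpose A *v c\<close> is the combination of the rows of \<open>A\<close> with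
  coefficients \<open>c\<close>, and a rotated frame has its rows in the same range.\<close>

lemma plane_of_oriented_span: "plane_of (oriented_span A) = range ((*v) (transpose A))"
proof -
  have "rows B \<subseteq> range ((*v) (transpose A))" if B: "B \<in> oriented_span A" for B
  proof -
    obtain R where "B = R ** A"
      using B by (auto simp: oriented_span_def)
    then have "row i B = transpose A *v row i R" for i
      by (simp add: row_def vec_eq_iff matrix_matrix_mult_def matrix_vector_mult_def transpose_def
          mult.commute)
    then show ?thesis
      by (auto simp: rows_def)
  qed
  moreover have "subspace (range ((*v) (transpose A)))"
    by (simp add: linear_subspace_image matrix_vector_mul_linear)
  ultimately have "plane_of (oriented_span A) \<subseteq> range ((*v) (transpose A))"
    unfolding plane_of_def by (intro span_minimal) auto
  moreover have "transpose A *v c \<in> plane_of (oriented_span A)" for c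
  proof -
    have "transpose A *v c = (\<Sum>i\<in>UNIV. c $ i *\<^sub>R row i A)"
      by (simp add: vec_eq_iff matrix_vector_mult_def transpose_def row_def mult.commute)
    moreover have "row i A \<in> (\<Union>B\<in>oriented_span A. rows B)" for i
      using self_mem_oriented_span by (force simp: rows_def)
    ultimately show ?thesis
      unfolding plane_of_def by (simp add: span_base span_scale span_sum)
  qed
  ultimately show ?thesis by auto
qed

lemma subspace_plane_of: "subspace (plane_of u)"
  by (simp add: plane_of_def)

text \<open>By orthonormality \<open>A\<close> is a left inverse of \<open>transpose A\<close>,
  which is therefore injective.\<close>

lemma dim_plane_of:
  fixes u :: "(real^'n^'p) set"
  assumes "u \<in> topspace oriented_grassmannian"
  shows "dim (plane_of u) = CARD('p)"
proof -
  obtain A where A: "A \<in> stiefel" "u = oriented_span A"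
    using assms by (auto simp: topspace_oriented_grassmannian)
  then have "inj ((*v) (transpose A))"
    by (metis inj_on_inverseI matrix_vector_mul_assoc matrix_vector_mul_lid stiefel_iff)
  then show ?thesis
    using A dim_image_eq[of "(*v) (transpose A)" UNIV]
    by (simp add: plane_of_oriented_span matrix_vector_mul_linear dim_UNIV)
qed

lemma plane_proj_mem:
  assumes "u \<in> topspace oriented_grassmannian"
  shows "plane_proj u *v x \<in> plane_of u"
proof -
  obtain A where "u = oriented_span A"
    using assms by (auto simp: topspace_oriented_grassmannian)
  then have "plane_proj u *v x = transpose A *v (A *v x)"
    by (simp add: plane_proj_oriented_span matrix_vector_mul_assoc)
  then show ?thesis
    by (simp add: \<open>u = oriented_span A\<close> plane_of_oriented_span)
qed

lemma plane_proj_ident: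
  assumes "u \<in> topspace oriented_grassmannian" "y \<in> plane_of u"
  shows "plane_proj u *v y = y"
proof -
  obtain A c where A: "A \<in> stiefel" "u = oriented_span A" "y = transpose A *v c"
    using assms by (auto simp: topspace_oriented_grassmannian plane_of_oriented_span)
  then have "plane_proj u *v y = transpose A *v ((A ** transpose A) *v c)"
    by (simp add: plane_proj_oriented_span matrix_vector_mul_assoc matrix_mul_assoc)
  then show ?thesis
    using A by (simp add: stiefel_iff)
qed

lemma plane_proj_self_adjoint:
  assumes "u \<in> topspace oriented_grassmannian"
  shows "(plane_proj u *v x) \<bullet> y = x \<bullet> (plane_proj u *v y)"
proof -
  obtain A where "u = oriented_span A"
    using assms by (auto simp: topspace_oriented_grassmannian)
  then have "(plane_proj u *v a) \<bullet> b = (A *v a) \<bullet> (A *v b)" for a b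
    by (simp add: plane_proj_oriented_span dot_lmul_matrix transpose_matrix_vector
        flip: matrix_vector_mul_assoc)
  then show ?thesis
    by (metis inner_commute)
qed

lemma plane_proj_eq_0_iff:
  assumes "u \<in> topspace oriented_grassmannian"
  shows "plane_proj u *v x = 0 \<longleftrightarrow> x \<in> (plane_of u)\<^sup>\<bottom>"
proof
  assume "plane_proj u *v x = 0"
  then have "x \<bullet> y = 0" if "y \<in> plane_of u" for y
    using plane_proj_self_adjoint[OF assms, of x y] plane_proj_ident[OF assms that] by simp
  then show "x \<in> (plane_of u)\<^sup>\<bottom>"
    by (simp add: orthogonal_comp_def orthogonal_def inner_commute)
next
  assume x: "x \<in> (plane_of u)\<^sup>\<bottom>"
  let ?y = "plane_proj u *v x"
  have y: "?y \<in> plane_of u"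
    by (rule plane_proj_mem[OF assms])
  have "?y \<bullet> ?y = x \<bullet> ?y"
    by (simp add: plane_proj_self_adjoint[OF assms] plane_proj_ident[OF assms y])
  also have "\<dots> = 0"
    using x y by (simp add: orthogonal_comp_def orthogonal_def inner_commute[of x])
  finally show "?y = 0" by simp
qed

lemma minus_plane_proj_mem:
  assumes "u \<in> topspace oriented_grassmannian"
  shows "x - plane_proj u *v x \<in> (plane_of u)\<^sup>\<bottom>"
proof -
  have "plane_proj u *v (x - plane_proj u *v x) = 0"
    using plane_proj_ident[OF assms plane_proj_mem[OF assms]]
    by (simp add: matrix_vector_mult_diff_distrib)
  then show ?thesis
    by (simp add: plane_proj_eq_0_iff[OF assms])
qed

lemma dim_orthogonal_comp_plane_of:
  fixes u :: "(real^'n^'p) set"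
  assumes "u \<in> topspace oriented_grassmannian"
  shows "dim ((plane_of u)\<^sup>\<bottom>) = CARD('n) - CARD('p)"
  using dim_subspace_orthogonal_to_vectors[OF subspace_plane_of subspace_UNIV, of u]
    dim_plane_of[OF assms]
  by (simp add: orthogonal_comp_def)

text \<open>The projection onto \<open>u\<close> fixes \<open>x\<close> and the one onto
  \<open>w\<close> kills it, so their difference fixes \<open>x\<close> although it shrinks every
  nonzero vector. Both injectivity arguments that feed invariance of domain rest on this.\<close>

lemma plane_of_Int_orthogonal_comp_close:
  assumes "u \<in> topspace oriented_grassmannian" "w \<in> topspace oriented_grassmannian"
    and "norm (plane_proj u - plane_proj w) < 1"
    and "x \<in> plane_of u" "x \<in> (plane_of w)\<^sup>\<bottom>"
  shows "x = 0"
proof (rule ccontr)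
  assume "x \<noteq> 0"
  have "x = (plane_proj u - plane_proj w) *v x"
    using plane_proj_ident[OF assms(1,4)] plane_proj_eq_0_iff[OF assms(2), of x] assms(5)
    by (simp add: matrix_vector_mult_diff_rdistrib)
  then have "norm x \<le> norm (plane_proj u - plane_proj w) * norm x"
    using norm_matrix_vector_mult_le by metis
  then show False
    using assms(3) \<open>x \<noteq> 0\<close> by simp
qed

subsection \<open>Topological manifolds\<close>

lemma homeomorphic_maps_subspace_Euclidean_space:
  fixes T :: "'a::euclidean_space set"
  assumes "subspace T"
  obtains f g where "homeomorphic_maps (top_of_set T) (Euclidean_space (dim T)) f g"
  using homeomorphic_subspace_Euclidean_space_dim[OF assms] unfolding homeomorphic_space_def by blast

text \<open>An inverse chart, moved from the model space to a linear subspace \<open>T\<close> of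
  the same dimension. With \<open>T\<close> an orthogonal complement, a parameter in
  \<open>T\<close> and a vector of the plane add up to a point of the whole space, where invariance
  of domain applies.\<close>

lemma topological_manifold_parametrization:
  fixes T :: "'a::euclidean_space set"
  assumes "topological_manifold (dim T) X" "subspace T" "x \<in> topspace X"
  obtains W \<phi> where "openin (top_of_set T) W" "continuous_map (top_of_set W) X \<phi>"
    "inj_on \<phi> W" "x \<in> \<phi> ` W"
proof -
  let ?E = "Euclidean_space (dim T)"
  obtain N V where N: "openin X N" "x \<in> N" and V: "openin ?E V"
    and NV: "subtopology X N homeomorphic_space subtopology ?E V"
    using assms unfolding topological_manifold_def by blast
  obtain h k where hk: "homeomorphic_maps (subtopology X N) (subtopology ?E V) h k"
    using NV unfolding homeomorphic_space_def by blast
  obtain f g where fg: "homeomorphic_maps (top_of_set T) ?E f g"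
    using homeomorphic_maps_subspace_Euclidean_space[OF assms(2)] .
  have NX: "topspace (subtopology X N) = N" and VE: "topspace (subtopology ?E V) = V"
    using openin_subset[OF N(1)] openin_subset[OF V] by auto
  have ch: "continuous_map (subtopology X N) (subtopology ?E V) h"
    and ck: "continuous_map (subtopology ?E V) (subtopology X N) k"
    and kh: "\<And>y. y \<in> N \<Longrightarrow> k (h y) = y" and hkV: "\<And>z. z \<in> V \<Longrightarrow> h (k z) = z"
    using hk NX VE by (auto simp: homeomorphic_maps_def)
  have cf: "continuous_map (top_of_set T) ?E f" and cg: "continuous_map ?E (top_of_set T) g"
    and gf: "\<And>t. t \<in> T \<Longrightarrow> g (f t) = t" and fgE: "\<And>z. z \<in> topspace ?E \<Longrightarrow> f (g z) = z"
    using fg by (auto simp: homeomorphic_maps_def)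
  define W where "W = {t \<in> T. f t \<in> V}"
  show ?thesis
  proof
    show "openin (top_of_set T) W"
      using openin_continuous_map_preimage[OF cf V] by (simp add: W_def)
    have "continuous_map (top_of_set W) ?E f"
      using continuous_map_from_subtopology[OF cf, of W]
      by (simp add: subtopology_subtopology W_def Int_absorb1 Collect_restrict)
    then have "continuous_map (top_of_set W) (subtopology ?E V) f"
      by (auto simp: continuous_map_in_subtopology W_def)
    then have "continuous_map (top_of_set W) (subtopology X N) (k \<circ> f)"
      using ck continuous_map_compose by blast
    then show "continuous_map (top_of_set W) X (k \<circ> f)"
      using continuous_map_in_subtopology by blast
    show "inj_on (k \<circ> f) W"
    proof (rule inj_on_inverseI)
      show "(g \<circ> h) ((k \<circ> f) t) = t" if "t \<in> W" for t
        using that by (simp add: W_def hkV gf)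
    qed
    have hx: "h x \<in> V"
      using ch NX VE N(2) by (auto simp: continuous_map_def)
    then have "h x \<in> topspace ?E"
      using openin_subset[OF V] by blast
    then have "g (h x) \<in> W" "f (g (h x)) = h x"
      using cg hx by (auto simp: W_def fgE continuous_map_def)
    then show "x \<in> (k \<circ> f) ` W"
      using kh[OF N(2)] by force
  qed
qed

text \<open>A continuous open injection is an embedding with open image, so its inverse is a chart;
  any subspace of dimension \<open>q\<close> may serve as the model.\<close>

lemma topological_manifoldI:
  assumes "Hausdorff_space X" "second_countable X"
    and charts: "\<And>x. x \<in> topspace X \<Longrightarrow>
      \<exists>(T :: 'a::euclidean_space set) S \<phi>. subspace T \<and> dim T = q \<and> openin (top_of_set T) S \<and>
        continuous_map (top_of_set S) X \<phi> \<and> open_map (top_of_set S) X \<phi> \<and> inj_on \<phi> S \<and> x \<in> \<phi> ` S"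
  shows "topological_manifold q X"
  unfolding topological_manifold_def
proof (intro conjI ballI assms(1,2))
  fix x assume "x \<in> topspace X"
  then obtain T :: "'a set" and S \<phi> where T: "subspace T" "dim T = q"
    and S: "openin (top_of_set T) S" and \<phi>: "continuous_map (top_of_set S) X \<phi>"
      "open_map (top_of_set S) X \<phi>" "inj_on \<phi> S" and x: "x \<in> \<phi> ` S"
    using charts by meson
  obtain f g where "homeomorphic_maps (top_of_set T) (Euclidean_space q) f g"
    using homeomorphic_maps_subspace_Euclidean_space T by metis
  then have f: "homeomorphic_map (top_of_set T) (Euclidean_space q) f"
    using homeomorphic_map_maps by blast
  have ST: "S \<subseteq> T"
    using openin_imp_subset[OF S] .
  have "openin (Euclidean_space q) (f ` S)"
    using S f ST by (simp add: homeomorphic_map_openness_eq)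
  moreover have "openin X (\<phi> ` S)"
    using \<phi>(2) by (simp add: open_map_def)
  moreover have "top_of_set S homeomorphic_space subtopology X (\<phi> ` S)"
    using injective_open_imp_embedding_map[OF \<phi>(1,2)] \<phi>(3)
    by (simp add: embedding_map_def homeomorphic_map_imp_homeomorphic_space)
  moreover have "top_of_set S homeomorphic_space subtopology (Euclidean_space q) (f ` S)"
  proof -
    have "homeomorphic_map (subtopology (top_of_set T) S) (subtopology (Euclidean_space q) (f ` S)) f"
    proof (rule homeomorphic_map_subtopologies[OF f])
      show "f ` (topspace (top_of_set T) \<inter> S) = topspace (Euclidean_space q) \<inter> f ` S"
        using ST homeomorphic_imp_surjective_map[OF f] by auto
    qed
    then show ?thesis
      using ST homeomorphic_map_imp_homeomorphic_space by (fastforce simp: subtopology_subtopology Int_absorb1)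
  qed
  ultimately show "\<exists>N W. openin X N \<and> x \<in> N \<and> openin (Euclidean_space q) W \<and>
      subtopology X N homeomorphic_space subtopology (Euclidean_space q) W"
    using x by (meson homeomorphic_space_sym homeomorphic_space_trans)
qed

subsection \<open>Skewness\<close>

text \<open>The sum of \<open>A\<close> and \<open>B\<close> has dimension
  \<open>dim A + dim B - dim (A \<inter> B)\<close>, and adding \<open>d\<close> raises it by one
  exactly if \<open>d\<close> lies outside. The largest possible value thus forces both properties
  at once.\<close>

lemma dim_span_Un_insert_iff:
  fixes A B :: "'a::euclidean_space set"
  assumes "subspace A" "subspace B"
  shows "dim (span (A \<union> B \<union> {d})) = dim A + dim B + 1 \<longleftrightarrow>
    A \<inter> B = {0} \<and> d \<notin> {x + y | x y. x \<in> A \<and> y \<in> B}"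
proof -
  let ?S = "{x + y | x y. x \<in> A \<and> y \<in> B}"
  have S: "span (A \<union> B) = ?S"
    by (simp add: span_Un assms[folded span_eq_iff])
  have "dim ?S = dim (A \<union> B)"
    using S dim_span by metis
  then have "dim (A \<union> B) + dim (A \<inter> B) = dim A + dim B"
    using dim_sums_Int[OF assms] by simp
  moreover have "dim (span (A \<union> B \<union> {d})) = (if d \<in> ?S then dim (A \<union> B) else dim (A \<union> B) + 1)"
    by (simp add: dim_insert S)
  moreover have "dim (A \<inter> B) = 0 \<longleftrightarrow> A \<inter> B = {0}"
    using assms subspace_0 by (auto simp: dim_eq_0)
  ultimately show ?thesis
    by auto
qed

text \<open>A common point has the form \<open>v1 - x = v2 + y\<close>, with \<open>x\<close> and
  \<open>y\<close> in the two directions; the sign is absorbed by the subspace.\<close>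

lemma points_of_Int_empty_iff:
  "points_of (u1, v1) \<inter> points_of (u2, v2) = {} \<longleftrightarrow>
    v1 - v2 \<notin> {x + y | x y. x \<in> plane_of u1 \<and> y \<in> plane_of u2}"
proof -
  have "v1 - v2 = x + y \<longleftrightarrow> v1 + - x = v2 + y" for x y
    by (auto simp: algebra_simps)
  moreover have "- x \<in> plane_of u1 \<longleftrightarrow> x \<in> plane_of u1" for x
    using subspace_neg[OF subspace_plane_of] minus_minus by metis
  ultimately show ?thesis
    unfolding points_of_def fst_conv snd_conv disjoint_iff mem_Collect_eq
    by (metis minus_minus)
qed

text \<open>Identifies the dimension condition (1) with skewness.\<close>

lemma skew_iff_dim:
  fixes u1 u2 :: "(real^'n^'p) set"
  assumes "u1 \<in> topspace oriented_grassmannian" "u2 \<in> topspace oriented_grassmannian"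
  shows "skew (u1, v1) (u2, v2) \<longleftrightarrow>
    dim (span (plane_of u1 \<union> plane_of u2 \<union> {v1 - v2})) = 2 * CARD('p) + 1"
  using dim_span_Un_insert_iff[OF subspace_plane_of subspace_plane_of, of u1 u2 "v1 - v2"]
  by (simp add: skew_def points_of_Int_empty_iff dim_plane_of assms mult_2 conj_commute)

subsection \<open>From a fibration to a section\<close>

text \<open>What a fibration says about its direction map alone: the level sets of
  \<open>dir\<close> are the fibers, and distinct fibers share no direction.\<close>

context
  fixes dir :: "real^'n \<Rightarrow> (real^'n^'p) set"
  assumes cont_dir: "continuous_map euclidean oriented_grassmannian dir"
    and dir_eq_iff: "\<And>x y. dir x = dir y \<longleftrightarrow> x - y \<in> plane_of (dir y)"
    and dir_eq_if_common: "\<And>x y z. z \<noteq> 0 \<Longrightarrow> z \<in> plane_of (dir x) \<Longrightarrow> z \<in> plane_of (dir y) \<Longrightarrow> dir x = dir y"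
begin

text \<open>Offsets \<open>t\<close> orthogonal to the fiber through \<open>x\<close>, restricted so
  that \<open>plane_of_Int_orthogonal_comp_close\<close> applies to \<open>dir (x + t)\<close> and
  \<open>dir x\<close>.\<close>

private abbreviation slice :: "real^'n \<Rightarrow> (real^'n) set" where
  "slice x \<equiv> {t \<in> (plane_of (dir x))\<^sup>\<bottom>. norm (plane_proj (dir (x + t)) - plane_proj (dir x)) < 1}"

lemma dir_mem: "dir x \<in> topspace oriented_grassmannian"
  using cont_dir by (auto simp: continuous_map_def)

lemma continuous_on_plane_proj_dir: "continuous_on UNIV (\<lambda>x. plane_proj (dir x))"
  using continuous_map_compose[OF cont_dir continuous_map_plane_proj] by (simp add: o_def)

lemma openin_slice: "openin (top_of_set ((plane_of (dir x))\<^sup>\<bottom>)) (slice x)"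
proof -
  have "continuous_on ((plane_of (dir x))\<^sup>\<bottom>) (\<lambda>t. norm (plane_proj (dir (x + t)) - plane_proj (dir x)))"
    by (intro continuous_intros continuous_on_compose2[OF continuous_on_plane_proj_dir]) auto
  then have "openin (top_of_set ((plane_of (dir x))\<^sup>\<bottom>))
      ((plane_of (dir x))\<^sup>\<bottom> \<inter> (\<lambda>t. norm (plane_proj (dir (x + t)) - plane_proj (dir x))) -` {..<1})"
    by (rule continuous_openin_preimage_gen) simp
  moreover have "(plane_of (dir x))\<^sup>\<bottom> \<inter> (\<lambda>t. norm (plane_proj (dir (x + t)) - plane_proj (dir x))) -` {..<1}
      = slice x"
    by auto
  ultimately show ?thesis
    by simp
qed

text \<open>Two offsets with the same direction differ by a vector of
  \<open>plane_of (dir (x + t))\<close> that is orthogonal to the nearby plane of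
  \<open>dir x\<close>.\<close>

lemma inj_on_dir_slice: "inj_on (\<lambda>t. dir (x + t)) (slice x)"
proof (rule inj_onI)
  fix s t assume s: "s \<in> slice x" and t: "t \<in> slice x" and "dir (x + s) = dir (x + t)"
  then have "s - t \<in> plane_of (dir (x + t))"
    by (simp add: dir_eq_iff)
  moreover have "s - t \<in> (plane_of (dir x))\<^sup>\<bottom>"
    using s t by (simp add: subspace_diff subspace_orthogonal_comp)
  ultimately show "s = t"
    using plane_of_Int_orthogonal_comp_close[OF dir_mem dir_mem, of "x + t" x "s - t"] t by simp
qed

text \<open>Nearness of directions is tested on a single vector \<open>z0\<close> of the plane of
  \<open>w\<close>: if its projection onto another fiber direction stays in an open set swept out by
  nonzero vectors of the planes over \<open>S\<close>, that direction belongs to the image of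
  \<open>S\<close>.\<close>

lemma openin_dir_slice:
  assumes S: "openin (top_of_set ((plane_of (dir x))\<^sup>\<bottom>)) S" "S \<subseteq> slice x"
  shows "openin (subtopology oriented_grassmannian (range dir)) ((\<lambda>t. dir (x + t)) ` S)"
proof (subst openin_subopen, intro ballI)
  let ?P = "plane_proj (dir x)"
  fix w assume "w \<in> (\<lambda>t. dir (x + t)) ` S"
  then obtain t0 where t0: "t0 \<in> S" "w = dir (x + t0)"
    by auto
  \<comment> \<open>The index type \<open>'p\<close> is nonempty, so the plane has positive
    dimension.\<close>
  have "plane_of (dir x) \<noteq> {0}"
    using dim_plane_of[OF dir_mem[of x]] by (metis dim_eq_0 order_refl zero_less_card_finite less_irrefl)
  then obtain y0 where y0: "y0 \<in> plane_of (dir x)" "y0 \<noteq> 0"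
    using subspace_0[OF subspace_plane_of] by blast
  \<comment> \<open>Every \<open>a\<close> splits into an offset \<open>t = a - ?P *v a\<close> and
    a vector \<open>y = ?P *v a\<close> of the plane; \<open>F\<close> projects \<open>y\<close>
    onto the plane over \<open>t\<close>. Excluding \<open>y = 0\<close> keeps \<open>F a\<close>
    nonzero, so that it determines the direction.\<close>
  define D where "D = {a. a - ?P *v a \<in> S \<and> ?P *v a \<noteq> 0}"
  define F where "F a = plane_proj (dir (x + (a - ?P *v a))) *v (?P *v a)" for a
  have Pa: "?P *v a \<in> plane_of (dir x)" for a
    by (rule plane_proj_mem[OF dir_mem])
  have F_mem: "F a \<in> plane_of (dir (x + (a - ?P *v a)))" for a
    unfolding F_def by (rule plane_proj_mem[OF dir_mem])
  \<comment> \<open>Projecting the plane of \<open>dir x\<close> onto a plane over \<open>S\<close>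
    is injective.\<close>
  have proj_inj: "b = 0" if "t \<in> S" "b \<in> plane_of (dir x)" "plane_proj (dir (x + t)) *v b = 0" for t b
  proof (rule plane_of_Int_orthogonal_comp_close[OF dir_mem dir_mem])
    show "norm (?P - plane_proj (dir (x + t))) < 1"
      using that S(2) by (auto simp: norm_minus_commute)
    show "b \<in> (plane_of (dir (x + t)))\<^sup>\<bottom>"
      using that plane_proj_eq_0_iff[OF dir_mem] by blast
  qed (use that in auto)
  have F_nz: "F a \<noteq> 0" if "a \<in> D" for a
    using that proj_inj[OF _ Pa] by (auto simp: D_def F_def)
  have "open D"
  proof -
    have "continuous_map euclidean (top_of_set ((plane_of (dir x))\<^sup>\<bottom>)) (\<lambda>a. a - ?P *v a)"
      using minus_plane_proj_mem[OF dir_mem]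
      by (auto simp: continuous_map_in_subtopology intro!: continuous_intros)
    from openin_continuous_map_preimage[OF this S(1)] have "open {a. a - ?P *v a \<in> S}"
      by simp
    moreover have "open {a. ?P *v a \<noteq> 0}"
      by (intro open_Collect_neq continuous_intros)
    ultimately show ?thesis
      unfolding D_def by (rule open_Collect_conj)
  qed
  moreover have "continuous_on D F"
    unfolding F_def
    by (intro continuous_intros continuous_on_compose2[OF continuous_on_plane_proj_dir]) auto
  moreover have "inj_on F D"
  proof (rule inj_onI)
    fix a b assume a: "a \<in> D" and b: "b \<in> D" and eq: "F a = F b"
    let ?s = "a - ?P *v a" and ?t = "b - ?P *v b"
    have st: "?s \<in> S" "?t \<in> S"
      using a b by (auto simp: D_def)
    have "dir (x + ?s) = dir (x + ?t)"
      using dir_eq_if_common[OF F_nz[OF a]] F_mem eq by metis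
    then have "?s = ?t"
      using inj_onD[OF inj_on_dir_slice] st S(2) by blast
    then have "plane_proj (dir (x + ?t)) *v (?P *v a - ?P *v b) = 0"
      using eq by (simp add: F_def matrix_vector_mult_diff_distrib)
    then have "?P *v a - ?P *v b = 0"
      using proj_inj[OF st(2)] subspace_diff[OF subspace_plane_of Pa Pa] by blast
    with \<open>?s = ?t\<close> show "a = b"
      by simp
  qed
  ultimately have FD: "open (F ` D)"
    using invariance_of_domain by blast
  define z0 where "z0 = plane_proj w *v y0"
  have z0: "F (t0 + y0) = z0" "t0 + y0 \<in> D"
  proof -
    have "?P *v t0 = 0"
      using t0(1) S(2) plane_proj_eq_0_iff[OF dir_mem] by blast
    then have "?P *v (t0 + y0) = y0"
      using plane_proj_ident[OF dir_mem y0(1)] by (simp add: matrix_vector_right_distrib)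
    then show "F (t0 + y0) = z0" "t0 + y0 \<in> D"
      using t0 y0 by (simp_all add: F_def D_def z0_def)
  qed
  define B where "B = {w' \<in> range dir. plane_proj w' *v z0 \<in> F ` D}"
  have "continuous_map (subtopology oriented_grassmannian (range dir)) euclidean (\<lambda>w'. plane_proj w' *v z0)"
  proof -
    have 1: "continuous_map euclidean euclidean (\<lambda>A :: real^'n^'n. A *v z0)"
      by (simp add: continuous_intros)
    have "continuous_map (subtopology oriented_grassmannian (range dir)) euclidean plane_proj"
      by (rule continuous_map_from_subtopology[OF continuous_map_plane_proj])
    from continuous_map_compose[OF this 1] show ?thesis
      by (simp add: o_def)
  qed
  from openin_continuous_map_preimage[OF this, of "F ` D"]
  have "openin (subtopology oriented_grassmannian (range dir)) B"
    using FD dir_mem by (simp add: B_def image_subset_iff inf.absorb2)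
  moreover have "w \<in> B"
  proof -
    have "plane_proj w *v z0 = z0"
      using t0(2) by (simp add: z0_def plane_proj_ident plane_proj_mem dir_mem)
    then show ?thesis
      using z0 t0 by (auto simp: B_def)
  qed
  moreover have "B \<subseteq> (\<lambda>t. dir (x + t)) ` S"
  proof
    fix w' assume "w' \<in> B"
    then obtain x' a where a: "w' = dir x'" "a \<in> D" "plane_proj w' *v z0 = F a"
      by (auto simp: B_def)
    then have "F a \<in> plane_of (dir x')"
      using plane_proj_mem[OF dir_mem] by metis
    then have "dir x' = dir (x + (a - ?P *v a))"
      using dir_eq_if_common[OF F_nz[OF a(2)] _ F_mem] by blast
    then show "w' \<in> (\<lambda>t. dir (x + t)) ` S"
      using a by (auto simp: D_def)
  qed
  ultimately show "\<exists>B. openin (subtopology oriented_grassmannian (range dir)) B \<and> w \<in> B \<and>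
      B \<subseteq> (\<lambda>t. dir (x + t)) ` S"
    by blast
qed

lemma zero_mem_slice: "0 \<in> slice x"
  by (simp add: subspace_0 subspace_orthogonal_comp)

lemma continuous_map_dir_range:
  "continuous_map euclidean (subtopology oriented_grassmannian (range dir)) dir"
  using cont_dir by (simp add: continuous_map_in_subtopology)

text \<open>Near a point \<open>x\<close> of \<open>A\<close>, the offsets in the slice that stay in
  \<open>A\<close> already give an open set of directions.\<close>

lemma open_map_dir: "open_map euclidean (subtopology oriented_grassmannian (range dir)) dir"
  unfolding open_map_def
proof (intro allI impI)
  fix A :: "(real^'n) set" assume "openin euclidean A"
  then have A: "open A" by simp
  show "openin (subtopology oriented_grassmannian (range dir)) (dir ` A)"
  proof (subst openin_subopen, clarify)
    fix x assume "x \<in> A"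
    define S where "S = {t \<in> slice x. x + t \<in> A}"
    have "S = slice x \<inter> (\<lambda>t. x + t) -` A"
      by (auto simp: S_def)
    moreover have "open ((\<lambda>t. x + t) -` A)"
      by (intro open_vimage A continuous_intros)
    ultimately have "openin (top_of_set ((plane_of (dir x))\<^sup>\<bottom>)) S"
      using openin_slice[of x] by (simp add: openin_Int_open)
    then have "openin (subtopology oriented_grassmannian (range dir)) ((\<lambda>t. dir (x + t)) ` S)"
      by (rule openin_dir_slice) (auto simp: S_def)
    moreover have "0 \<in> S"
      using zero_mem_slice \<open>x \<in> A\<close> by (simp add: S_def)
    then have "dir x \<in> (\<lambda>t. dir (x + t)) ` S"
      by force
    moreover have "(\<lambda>t. dir (x + t)) ` S \<subseteq> dir ` A"
      by (auto simp: S_def)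
    ultimately show "\<exists>B. openin (subtopology oriented_grassmannian (range dir)) B \<and> dir x \<in> B \<and> B \<subseteq> dir ` A"
      by blast
  qed
qed

lemma range_dir_subset: "range dir \<subseteq> topspace oriented_grassmannian"
  using dir_mem by blast

text \<open>Reduces continuity of a function of the direction to continuity of its composition with
  \<open>dir\<close> on the whole space.\<close>

lemma quotient_map_dir: "quotient_map euclidean (subtopology oriented_grassmannian (range dir)) dir"
  by (intro continuous_open_imp_quotient_map continuous_map_dir_range open_map_dir)
    (use range_dir_subset in auto)

lemma topological_submanifold_range_dir:
  "topological_submanifold (CARD('n) - CARD('p)) oriented_grassmannian (range dir)"
  unfolding topological_submanifold_def
proof (intro conjI range_dir_subset topological_manifoldI)
  show "Hausdorff_space (subtopology oriented_grassmannian (range dir))"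
    by (intro Hausdorff_space_subtopology Hausdorff_oriented_grassmannian)
  show "second_countable (subtopology oriented_grassmannian (range dir))"
    by (intro second_countable_subtopology second_countable_oriented_grassmannian)
  fix w assume "w \<in> topspace (subtopology oriented_grassmannian (range dir))"
  then obtain x where x: "w = dir x" by auto
  let ?T = "(plane_of (dir x))\<^sup>\<bottom>" and ?X = "subtopology oriented_grassmannian (range dir)"
  let ?\<phi> = "\<lambda>t. dir (x + t)"
  have "continuous_map (top_of_set (slice x)) ?X ?\<phi>"
  proof -
    have "continuous_map (top_of_set (slice x)) euclidean (\<lambda>t. x + t)"
      by (simp add: continuous_intros)
    from continuous_map_compose[OF this continuous_map_dir_range] show ?thesis
      by (simp add: o_def)
  qed
  moreover have "open_map (top_of_set (slice x)) ?X ?\<phi>"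
    unfolding open_map_def
  proof (intro allI impI)
    fix S assume S: "openin (top_of_set (slice x)) S"
    then show "openin ?X (?\<phi> ` S)"
      using openin_dir_slice[OF openin_trans[OF S openin_slice]] openin_imp_subset[OF S] by blast
  qed
  moreover have "w \<in> ?\<phi> ` slice x"
    using x zero_mem_slice by force
  ultimately show "\<exists>(T :: (real^'n) set) S \<phi>. subspace T \<and> dim T = CARD('n) - CARD('p) \<and>
      openin (top_of_set T) S \<and> continuous_map (top_of_set S) ?X \<phi> \<and> open_map (top_of_set S) ?X \<phi> \<and>
      inj_on \<phi> S \<and> w \<in> \<phi> ` S"
    using subspace_orthogonal_comp dim_orthogonal_comp_plane_of[OF dir_mem] openin_slice inj_on_dir_slice
    by (intro exI[of _ ?T] exI[of _ "slice x"] exI[of _ ?\<phi>]) simp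
qed

end

section \<open>Feet of affine planes\<close>

lemma mem_points_of_iff: "x \<in> points_of (u, v) \<longleftrightarrow> x - v \<in> plane_of u"
  by (force simp: points_of_def algebra_simps)

text \<open>The projection fixes \<open>x - v\<close> and kills \<open>v\<close>. The resulting
  formula shows the foot to depend continuously on the point and the direction.\<close>

lemma mem_points_of_iff_foot:
  assumes "u \<in> topspace oriented_grassmannian" "v \<in> (plane_of u)\<^sup>\<bottom>"
  shows "x \<in> points_of (u, v) \<longleftrightarrow> v = x - plane_proj u *v x"
proof
  assume "x \<in> points_of (u, v)"
  then have "plane_proj u *v (x - v) = x - v"
    by (simp add: mem_points_of_iff plane_proj_ident assms)
  moreover have "plane_proj u *v v = 0"
    using assms plane_proj_eq_0_iff by blast
  ultimately show "v = x - plane_proj u *v x"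
    by (simp add: matrix_vector_mult_diff_distrib)
next
  assume "v = x - plane_proj u *v x"
  then show "x \<in> points_of (u, v)"
    by (simp add: mem_points_of_iff plane_proj_mem assms)
qed

text \<open>\<open>U\<close> is the range of the direction map, and \<open>v\<close> sends a
  direction to the foot of the fiber having it.\<close>

lemma fibration_imp_section:
  fixes M :: "((real^'n^'p) set \<times> (real^'n)) set"
  assumes "is_fibration M"
  obtains U v where "U \<noteq> {}"
    "topological_submanifold (CARD('n) - CARD('p)) oriented_grassmannian U"
    "connectedin oriented_grassmannian U"
    "contractible_space (subtopology oriented_grassmannian U)"
    "xi_section U v" "M = {(u, v u) | u. u \<in> U}"
    "\<And>s u. \<lbrakk>\<forall>k. s k \<in> U; u \<in> topspace oriented_grassmannian - U;
      limitin oriented_grassmannian s u sequentially\<rbrakk> \<Longrightarrow>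
      filterlim (\<lambda>k. norm (v (s k))) at_top sequentially"
proof -
  let ?G = "oriented_grassmannian :: (real^'n^'p) set topology"
  have M: "M \<subseteq> affine_oriented_grassmannian"
    and ex1: "\<And>x. \<exists>!P. P \<in> M \<and> x \<in> points_of P"
    and cont: "continuous_map euclidean ?G (\<lambda>x. fst (fiber_through M x))"
    and skew: "\<And>P Q. P \<in> M \<Longrightarrow> Q \<in> M \<Longrightarrow> P \<noteq> Q \<Longrightarrow> skew P Q"
    using assms by (auto simp: is_fibration_def)
  define dir where "dir x = fst (fiber_through M x)" for x
  define foot where "foot x = snd (fiber_through M x)" for x
  have fiber: "(dir x, foot x) \<in> M" "x \<in> points_of (dir x, foot x)" for x
    using theI'[OF ex1[of x]] by (simp_all add: dir_def foot_def fiber_through_def)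
  have dirI: "dir x = u" "foot x = w" if "(u, w) \<in> M" "x \<in> points_of (u, w)" for x u w
    using the1_equality[OF ex1[of x], of "(u, w)"] that
    by (simp_all add: dir_def foot_def fiber_through_def)
  have G: "u \<in> topspace ?G" "w \<in> (plane_of u)\<^sup>\<bottom>" if "(u, w) \<in> M" for u w
    using M that by (auto simp: affine_oriented_grassmannian_def)
  have foot_eq: "foot x = x - plane_proj (dir x) *v x" for x
    using mem_points_of_iff_foot[OF G[OF fiber(1)]] fiber(2) by simp
  have common: "P = Q" if "P \<in> M" "Q \<in> M" "z \<noteq> 0" "z \<in> plane_of (fst P)" "z \<in> plane_of (fst Q)"
    for P Q z
    using skew[OF that(1,2)] that(3-5) by (auto simp: skew_def)
  \<comment> \<open>Fibers with equal direction share a nonzero vector, so they coincide.\<close>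
  have same_dir: "foot x = foot y" if "dir x = dir y" for x y
  proof -
    have "plane_of (dir x) \<noteq> {0}"
      using dim_plane_of[OF G(1)[OF fiber(1)[of x]]]
      by (metis dim_eq_0 order_refl zero_less_card_finite less_irrefl)
    then obtain z where "z \<in> plane_of (dir x)" "z \<noteq> 0"
      using subspace_0[OF subspace_plane_of] by blast
    then show ?thesis
      using common[OF fiber(1)[of x] fiber(1)[of y]] that by simp
  qed
  have dir_eq_iff: "dir x = dir y \<longleftrightarrow> x - y \<in> plane_of (dir y)" for x y
  proof
    assume eq: "dir x = dir y"
    then have "x - foot x \<in> plane_of (dir y)" "y - foot y \<in> plane_of (dir y)"
      using fiber(2)[of x] fiber(2)[of y] by (simp_all add: mem_points_of_iff)
    from subspace_diff[OF subspace_plane_of this] show "x - y \<in> plane_of (dir y)"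
      by (simp add: same_dir[OF eq])
  next
    assume "x - y \<in> plane_of (dir y)"
    moreover have "y - foot y \<in> plane_of (dir y)"
      using fiber(2)[of y] by (simp add: mem_points_of_iff)
    ultimately have "(x - y) + (y - foot y) \<in> plane_of (dir y)"
      by (rule subspace_add[OF subspace_plane_of])
    then have "x \<in> points_of (dir y, foot y)"
      by (simp add: mem_points_of_iff)
    then show "dir x = dir y"
      by (rule dirI(1)[OF fiber(1)])
  qed
  have dir_common: "dir x = dir y" if "z \<noteq> 0" "z \<in> plane_of (dir x)" "z \<in> plane_of (dir y)" for x y z
    using common[OF fiber(1) fiber(1) that(1)] that(2,3) by simp
  have cont_dir: "continuous_map euclidean ?G dir"
    using cont by (simp add: dir_def[abs_def])
  note dir = cont_dir dir_eq_iff dir_common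
  let ?U = "range dir" and ?X = "subtopology ?G (range dir)"
  \<comment> \<open>By \<open>same_dir\<close> the chosen point does not matter as long as
    \<open>u\<close> is in the range of \<open>dir\<close>.\<close>
  define v where "v u = foot (SOME x. dir x = u)" for u
  have v_dir: "v (dir x) = foot x" for x
    unfolding v_def by (rule same_dir) (rule someI[of "\<lambda>y. dir y = dir x" x], simp)
  \<comment> \<open>The foot lies on its own fiber. Hence \<open>v\<close> is a right inverse of
    \<open>dir\<close> on \<open>U\<close>, which gives both the retraction and properness.\<close>
  have dir_foot: "dir (foot x) = dir x" for x
  proof (rule dirI(1)[OF fiber(1)])
    show "foot x \<in> points_of (dir x, foot x)"
      by (simp add: mem_points_of_iff subspace_0 subspace_plane_of)
  qed
  have cont_v: "continuous_map ?X euclidean v"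
  proof (rule continuous_compose_quotient_map[OF quotient_map_dir[OF dir]])
    have "continuous_on UNIV foot"
      unfolding foot_eq[abs_def]
      by (intro continuous_intros continuous_on_plane_proj_dir[OF dir])
    then show "continuous_map euclidean euclidean (v \<circ> dir)"
      by (simp add: o_def v_dir)
  qed
  show ?thesis
  proof
    show "?U \<noteq> {}"
      by simp
    show "topological_submanifold (CARD('n) - CARD('p)) ?G ?U"
      by (rule topological_submanifold_range_dir[OF dir])
    have "connectedin ?G (dir ` UNIV)"
      by (rule connectedin_continuous_map_image[OF cont_dir]) (simp add: connected_UNIV)
    then show "connectedin ?G ?U" .
    have "retraction_map euclidean ?X dir"
      unfolding retraction_map_def retraction_maps_def
      using continuous_map_dir_range[OF dir] cont_v
      by (intro exI[of _ v]) (auto simp: v_dir dir_foot)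
    then show "contractible_space ?X"
    proof (rule contractible_space_retraction_map_image)
      show "contractible_space (euclidean :: (real^'n) topology)"
        using contractible_space_top_of_set[of "UNIV :: (real^'n) set"]
        by (simp add: convex_imp_contractible)
    qed
    show "xi_section ?U v"
    proof -
      have "continuous_map ?X ?G (\<lambda>u. u)"
        by (rule continuous_map_from_subtopology) simp
      then have "continuous_map ?X (prod_topology ?G euclidean) (\<lambda>u. (u, v u))"
        using cont_v by (simp add: continuous_map_paired)
      moreover have "v (dir x) \<in> (plane_of (dir x))\<^sup>\<bottom>" for x
        using G(2)[OF fiber(1)] by (simp add: v_dir)
      ultimately show ?thesis
        by (auto simp: xi_section_def xi_bundle_def continuous_map_in_subtopology)
    qed
    show "M = {(u, v u) | u. u \<in> ?U}"
    proof
      show "M \<subseteq> {(u, v u) | u. u \<in> ?U}"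
      proof clarify
        fix u w assume uw: "(u, w) \<in> M"
        have "w \<in> points_of (u, w)"
          by (simp add: mem_points_of_iff subspace_0 subspace_plane_of)
        from dirI[OF uw this] v_dir[of w] have "u = dir w" "w = v u"
          by simp_all
        then show "\<exists>u'. (u, w) = (u', v u') \<and> u' \<in> ?U"
          by (intro exI[of _ u]) simp
      qed
      show "{(u, v u) | u. u \<in> ?U} \<subseteq> M"
        using fiber(1) by (auto simp: v_dir)
    qed
    fix s u
    assume s: "\<forall>k. s k \<in> ?U" and u: "u \<in> topspace ?G - ?U" and lim: "limitin ?G s u sequentially"
    show "filterlim (\<lambda>k. norm (v (s k))) at_top sequentially"
    proof (rule ccontr)
      \<comment> \<open>Otherwise some subsequence of the feet converges to a point
        \<open>x\<close>. The direction at the foot of \<open>s k\<close> is \<open>s k\<close>, so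
        continuity gives the limit \<open>dir x\<close> in \<open>U\<close>, and uniqueness of
        limits makes it \<open>u\<close>.\<close>
      assume "\<not> filterlim (\<lambda>k. norm (v (s k))) at_top sequentially"
      then obtain C where "\<not> eventually (\<lambda>k. C \<le> norm (v (s k))) sequentially"
        unfolding filterlim_at_top by blast
      then have inf: "\<exists>k\<ge>m. norm (v (s k)) < C" for m
        by (auto simp: eventually_sequentially not_le)
      obtain r :: "nat \<Rightarrow> nat" where r: "strict_mono r" "\<And>k. norm (v (s (r k))) < C"
      proof -
        have "infinite {k. norm (v (s k)) < C}"
          using inf by (auto simp: infinite_nat_iff_unbounded_le)
        then show ?thesis
          using that infinite_enumerate[of "{k. norm (v (s k)) < C}"] by auto
      qed
      have "bounded (range (\<lambda>k. v (s (r k))))"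
        using r(2) by (intro boundedI[of _ C]) (auto intro: less_imp_le)
      then obtain x r' where r': "strict_mono r'" "((\<lambda>k. v (s (r k))) \<circ> r') \<longlonglongrightarrow> x"
        using bounded_imp_convergent_subsequence by blast
      have "dir (v (s k)) = s k" for k
      proof -
        obtain y where "s k = dir y"
          using s by blast
        then show ?thesis
          by (simp add: v_dir dir_foot)
      qed
      then have "limitin ?G (s \<circ> (r \<circ> r')) (dir x) sequentially"
        using continuous_map_limit[OF cont_dir, of "(\<lambda>k. v (s (r k))) \<circ> r'" x sequentially] r'(2)
        by (simp add: o_def)
      moreover have "limitin ?G (s \<circ> (r \<circ> r')) u sequentially"
        using limitin_subsequence[OF strict_mono_o[OF r(1) r'(1)] lim] .
      ultimately have "dir x = u"
        by (rule limitin_Hausdorff_unique[OF _ _ trivial_limit_sequentially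
            Hausdorff_oriented_grassmannian])
      then show False
        using u by blast
    qed
  qed
qed

subsection \<open>From a section to a fibration\<close>

text \<open>The union \<open>C\<close> of the planes is open, closed and nonempty, so it is the
  whole connected space; skewness makes the plane through a point unique.\<close>

lemma section_imp_fibration:
  fixes U :: "(real^'n^'p) set set" and v :: "(real^'n^'p) set \<Rightarrow> real^'n"
  assumes "U \<noteq> {}"
    and manifold: "topological_submanifold (CARD('n) - CARD('p)) oriented_grassmannian U"
    and sec: "xi_section U v"
    and skew: "\<And>u w. u \<in> U \<Longrightarrow> w \<in> U \<Longrightarrow> u \<noteq> w \<Longrightarrow> skew (u, v u) (w, v w)"
    and proper: "\<And>s u. \<lbrakk>\<forall>k. s k \<in> U; u \<in> (oriented_grassmannian closure_of U) - U;
      limitin oriented_grassmannian s u sequentially\<rbrakk> \<Longrightarrow>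
      filterlim (\<lambda>k. norm (v (s k))) at_top sequentially"
  shows "is_fibration {(u, v u) | u. u \<in> U}"
proof -
  let ?G = "oriented_grassmannian :: (real^'n^'p) set topology"
  let ?X = "subtopology ?G U"
  have U: "U \<subseteq> topspace ?G" and manX: "topological_manifold (CARD('n) - CARD('p)) ?X"
    using manifold by (auto simp: topological_submanifold_def)
  then have topX: "topspace ?X = U"
    by auto
  have uG: "u \<in> topspace ?G" if "u \<in> U" for u
    using that U by blast
  have "continuous_map ?X (prod_topology ?G euclidean) (\<lambda>u. (u, v u))"
    and vU: "v u \<in> (plane_of u)\<^sup>\<bottom>" if "u \<in> U" for u
    using sec that topX by (auto simp: xi_section_def xi_bundle_def continuous_map_in_subtopology)
  then have cont_v: "continuous_map ?X euclidean v"
    using \<open>U \<noteq> {}\<close> by (auto simp: continuous_map_pairwise o_def)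
  have cont_proj: "continuous_map ?X euclidean plane_proj"
    by (rule continuous_map_from_subtopology[OF continuous_map_plane_proj])
  have mem_iff: "x \<in> points_of (u, v u) \<longleftrightarrow> v u = x - plane_proj u *v x" if "u \<in> U" for u x
    by (rule mem_points_of_iff_foot[OF uG[OF that] vU[OF that]])
  have unique: "u = w" if "u \<in> U" "w \<in> U" "x \<in> points_of (u, v u)" "x \<in> points_of (w, v w)" for u w x
    using skew[OF that(1,2)] that(3,4) by (auto simp: skew_def)

  \<comment> \<open>Serves twice: with \<open>N\<close> the whole Grassmannian it shows that
    \<open>C\<close> is open, with arbitrary \<open>N\<close> that the direction is
    continuous.\<close>
  have nbhd: "\<exists>A. open A \<and> x \<in> A \<and> (\<forall>a\<in>A. \<exists>u\<in>U \<inter> N. a \<in> points_of (u, v u))"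
    if u0: "u0 \<in> U" "x \<in> points_of (u0, v u0)" and N: "openin ?G N" "u0 \<in> N" for u0 x N
  proof -
    let ?T = "(plane_of u0)\<^sup>\<bottom>" and ?P = "plane_proj u0"
    have T: "subspace ?T" "dim ?T = CARD('n) - CARD('p)"
      by (simp_all add: subspace_orthogonal_comp dim_orthogonal_comp_plane_of[OF uG[OF u0(1)]])
    obtain W \<phi> where W: "openin (top_of_set ?T) W" and \<phi>: "continuous_map (top_of_set W) ?X \<phi>"
      "inj_on \<phi> W" "u0 \<in> \<phi> ` W"
      using topological_manifold_parametrization[of ?T ?X u0] manX T u0(1) topX by metis
    \<comment> \<open>Keeps the parameters whose direction lies in \<open>N\<close> and is close
      enough to \<open>u0\<close> for \<open>plane_of_Int_orthogonal_comp_close\<close>.\<close>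
    define W' where "W' = {t \<in> W. \<phi> t \<in> N \<and> norm (plane_proj (\<phi> t) - ?P) < 1}"
    have \<phi>U: "\<phi> t \<in> U" if "t \<in> W" for t
      using \<phi>(1) that topX by (auto simp: continuous_map_def)
    have cont_proj\<phi>: "continuous_on W (\<lambda>t. plane_proj (\<phi> t))"
      using continuous_map_compose[OF \<phi>(1) cont_proj] by (simp add: o_def)
    have cont_v\<phi>: "continuous_on W (\<lambda>t. v (\<phi> t))"
      using continuous_map_compose[OF \<phi>(1) cont_v] by (simp add: o_def)
    have "openin (top_of_set W) {t \<in> W. \<phi> t \<in> N}"
      using openin_continuous_map_preimage[of "top_of_set W" ?G \<phi> N] \<phi>(1) N(1)
      by (simp add: continuous_map_in_subtopology)
    moreover have "openin (top_of_set W) {t \<in> W. norm (plane_proj (\<phi> t) - ?P) < 1}"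
    proof -
      have "continuous_map (top_of_set W) euclidean (\<lambda>t. norm (plane_proj (\<phi> t) - ?P))"
        by (simp add: continuous_intros cont_proj\<phi>)
      from openin_continuous_map_preimage[OF this, of "{..<1}"] show ?thesis
        by simp
    qed
    ultimately have "openin (top_of_set W) ({t \<in> W. \<phi> t \<in> N} \<inter> {t \<in> W. norm (plane_proj (\<phi> t) - ?P) < 1})"
      by (rule openin_Int)
    then have "openin (top_of_set W) W'"
      by (simp add: W'_def Int_def conj_ac cong: conj_cong)
    then have W': "openin (top_of_set ?T) W'"
      using W by (rule openin_trans)
    define D where "D = {a. a - ?P *v a \<in> W'}"
    \<comment> \<open>With \<open>a\<close> split as offset plus vector of the plane of
      \<open>u0\<close>, the offset selects a direction and the vector, projected to it, a point of
      that affine plane.\<close>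
    define F where "F a = v (\<phi> (a - ?P *v a)) + plane_proj (\<phi> (a - ?P *v a)) *v (?P *v a)" for a
    have Pa: "?P *v a \<in> plane_of u0" for a
      by (rule plane_proj_mem[OF uG[OF u0(1)]])
    have F_mem: "F a \<in> points_of (\<phi> (a - ?P *v a), v (\<phi> (a - ?P *v a)))" if "a \<in> D" for a
      using that plane_proj_mem[OF uG[OF \<phi>U]]
      by (simp add: mem_points_of_iff F_def D_def W'_def)
    have "open D"
    proof -
      have "continuous_map euclidean (top_of_set ?T) (\<lambda>a. a - ?P *v a)"
        using minus_plane_proj_mem[OF uG[OF u0(1)]]
        by (auto simp: continuous_map_in_subtopology intro!: continuous_intros)
      from openin_continuous_map_preimage[OF this W'] show ?thesis
        by (simp add: D_def)
    qed
    moreover have "continuous_on D F"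
    proof -
      have "continuous_on D (\<lambda>a. a - ?P *v a)" "(\<lambda>a. a - ?P *v a) ` D \<subseteq> W"
        by (auto simp: D_def W'_def intro!: continuous_intros)
      then show ?thesis
        unfolding F_def
        by (intro continuous_intros continuous_on_compose2[OF cont_proj\<phi>]
            continuous_on_compose2[OF cont_v\<phi>])
    qed
    moreover have "inj_on F D"
    proof (rule inj_onI)
      fix a b assume a: "a \<in> D" and b: "b \<in> D" and eq: "F a = F b"
      let ?s = "a - ?P *v a" and ?t = "b - ?P *v b"
      have st: "?s \<in> W'" "?t \<in> W'"
        using a b by (simp_all add: D_def)
      then have stW: "?s \<in> W" "?t \<in> W"
        by (simp_all add: W'_def)
      have "\<phi> ?s = \<phi> ?t"
        using unique[OF \<phi>U[OF stW(1)] \<phi>U[OF stW(2)] F_mem[OF a]] F_mem[OF b] eq by simp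
      then have "?s = ?t"
        using inj_onD[OF \<phi>(2) _ stW] by simp
      let ?d = "?P *v a - ?P *v b"
      have "plane_proj (\<phi> ?t) *v ?d = 0"
        using eq \<open>?s = ?t\<close> by (simp add: F_def matrix_vector_mult_diff_distrib)
      then have "?d \<in> (plane_of (\<phi> ?t))\<^sup>\<bottom>"
        using plane_proj_eq_0_iff[OF uG[OF \<phi>U[OF stW(2)]]] by blast
      moreover have "norm (?P - plane_proj (\<phi> ?t)) < 1"
        using st(2) by (simp add: W'_def norm_minus_commute)
      ultimately have "?d = 0"
        using plane_of_Int_orthogonal_comp_close[OF uG[OF u0(1)] uG[OF \<phi>U[OF stW(2)]]]
          subspace_diff[OF subspace_plane_of Pa Pa] by blast
      with \<open>?s = ?t\<close> show "a = b"
        by simp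
    qed
    ultimately have "open (F ` D)"
      using invariance_of_domain by blast
    moreover have "x \<in> F ` D"
    proof -
      \<comment> \<open>The preimage of \<open>x\<close> is \<open>t0 + (x - v u0)\<close>: the
        parameter \<open>t0\<close> of \<open>u0\<close> is orthogonal to the plane, while
        \<open>x - v u0\<close> lies in it.\<close>
      obtain t0 where t0: "t0 \<in> W" "\<phi> t0 = u0"
        using \<phi>(3) by auto
      have "t0 \<in> ?T"
        using openin_imp_subset[OF W] t0(1) by blast
      then have "?P *v t0 = 0"
        using plane_proj_eq_0_iff[OF uG[OF u0(1)]] by blast
      moreover have "x - v u0 \<in> plane_of u0"
        using u0(2) by (simp add: mem_points_of_iff)
      then have "?P *v (x - v u0) = x - v u0"
        by (rule plane_proj_ident[OF uG[OF u0(1)]])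
      ultimately have "?P *v (t0 + (x - v u0)) = x - v u0"
        by (simp only: matrix_vector_right_distrib add_0)
      moreover from this have "F (t0 + (x - v u0)) = x"
        using \<open>?P *v (x - v u0) = x - v u0\<close> by (simp add: F_def t0)
      moreover have "t0 \<in> W'"
        using t0 N(2) by (simp add: W'_def)
      ultimately show ?thesis
        by (intro image_eqI[of _ _ "t0 + (x - v u0)"]) (simp_all add: D_def)
    qed
    moreover have "\<exists>u\<in>U \<inter> N. a \<in> points_of (u, v u)" if "a \<in> F ` D" for a
      using that F_mem \<phi>U by (fastforce simp: D_def W'_def)
    ultimately show ?thesis
      by blast
  qed

  define C where "C = {x. \<exists>u\<in>U. x \<in> points_of (u, v u)}"
  have "open C"
  proof (subst open_subopen, intro ballI)
    fix x assume "x \<in> C"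
    then obtain u where "u \<in> U" "x \<in> points_of (u, v u)"
      by (auto simp: C_def)
    from nbhd[OF this openin_topspace uG[OF this(1)]]
    show "\<exists>A. open A \<and> x \<in> A \<and> A \<subseteq> C"
      unfolding C_def by blast
  qed
  moreover have "closed C"
    unfolding closed_sequential_limits
  proof (intro allI impI, elim conjE)
    fix x a assume "\<forall>k. x k \<in> C" and lim: "x \<longlonglongrightarrow> a"
    then have "\<forall>k. \<exists>u\<in>U. x k \<in> points_of (u, v u)"
      by (simp add: C_def)
    then obtain s where s: "\<And>k. s k \<in> U" "\<And>k. x k \<in> points_of (s k, v (s k))"
      by metis
    have "\<forall>k. \<exists>A\<in>stiefel. s k = oriented_span A"
      using uG[OF s(1)] by (auto simp: topspace_oriented_grassmannian)
    then obtain B where B: "\<And>k. B k \<in> stiefel" "\<And>k. s k = oriented_span (B k)"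
      by metis
    obtain A r where A: "A \<in> stiefel" and r: "strict_mono r" "(B \<circ> r) \<longlonglongrightarrow> A"
      using compact_stiefel B(1) unfolding compact_def by metis
    define u where "u = oriented_span A"
    have lim_s: "limitin ?G (s \<circ> r) u sequentially"
      using limitin_oriented_span[OF r(2) _ A] B by (simp add: u_def o_def)
    have sr: "\<forall>k. (s \<circ> r) k \<in> U"
      using s(1) by simp
    have "(\<lambda>k. plane_proj (s (r k))) \<longlonglongrightarrow> plane_proj u"
      using continuous_map_limit[OF continuous_map_plane_proj lim_s] by (simp add: o_def)
    moreover have "continuous_on UNIV (\<lambda>(Q :: real^'n^'n, y). y - Q *v y)"
      unfolding case_prod_unfold by (intro continuous_intros)
    moreover have lim_x: "(\<lambda>k. x (r k)) \<longlonglongrightarrow> a"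
      using LIMSEQ_subseq_LIMSEQ[OF lim r(1)] by (simp add: o_def)
    ultimately have "(\<lambda>k. x (r k) - plane_proj (s (r k)) *v x (r k)) \<longlonglongrightarrow> a - plane_proj u *v a"
      using continuous_on_tendsto_compose[of UNIV "\<lambda>(Q :: real^'n^'n, y). y - Q *v y"
          "\<lambda>k. (plane_proj (s (r k)), x (r k))" "(plane_proj u, a)" sequentially]
      by (simp add: tendsto_Pair)
    moreover have "x (r k) - plane_proj (s (r k)) *v x (r k) = v (s (r k))" for k
      using mem_iff[OF s(1)] s(2) by simp
    ultimately have lim_v: "(\<lambda>k. v (s (r k))) \<longlonglongrightarrow> a - plane_proj u *v a"
      by simp
    have "u \<in> U"
    \<comment> \<open>Outside \<open>U\<close> the limit \<open>u\<close> would be a boundary point,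
      and properness would make the norms of the feet diverge; yet the feet converge by
      \<open>lim_v\<close>.\<close>
    proof (rule ccontr)
      assume "u \<notin> U"
      moreover have "u \<in> ?G closure_of U"
        unfolding in_closure_of
      proof (intro conjI allI impI)
        show "u \<in> topspace ?G"
          using limitin_topspace[OF lim_s] .
        fix N assume "u \<in> N \<and> openin ?G N"
        then have "eventually (\<lambda>k. (s \<circ> r) k \<in> N) sequentially"
          using lim_s by (simp add: limitin_def)
        then show "\<exists>w. w \<in> U \<and> w \<in> N"
          using sr by (auto simp: eventually_sequentially)
      qed
      ultimately have "filterlim (\<lambda>k. norm (v ((s \<circ> r) k))) at_top sequentially"
        using proper[OF sr _ lim_s] by blast
      moreover have "(\<lambda>k. norm (v ((s \<circ> r) k))) \<longlonglongrightarrow> norm (a - plane_proj u *v a)"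
        using tendsto_norm[OF lim_v] by (simp add: o_def)
      ultimately show False
        using not_tendsto_and_filterlim_at_infinity filterlim_at_top_imp_at_infinity
          trivial_limit_sequentially by blast
    qed
    then have "limitin ?X (s \<circ> r) u sequentially"
      using lim_s sr by (simp add: limitin_subtopology)
    from continuous_map_limit[OF cont_v this] have "(\<lambda>k. v (s (r k))) \<longlonglongrightarrow> v u"
      by (simp add: o_def)
    \<comment> \<open>Continuity of \<open>v\<close> at \<open>u\<close> and the explicit formula
      give two limits of the same feet; their equality puts \<open>a\<close> on the plane over
      \<open>u\<close>.\<close>
    then have "v u = a - plane_proj u *v a"
      using lim_v LIMSEQ_unique by blast
    then show "a \<in> C"
      using mem_iff[OF \<open>u \<in> U\<close>, of a] \<open>u \<in> U\<close> unfolding C_def by blast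
  qed
  moreover have "C \<noteq> {}"
  proof -
    obtain u where "u \<in> U"
      using \<open>U \<noteq> {}\<close> by blast
    moreover have "v u \<in> points_of (u, v u)"
      by (simp add: mem_points_of_iff subspace_0 subspace_plane_of)
    ultimately have "v u \<in> C"
      unfolding C_def by blast
    then show ?thesis by blast
  qed
  ultimately have "C = UNIV"
    using clopen by blast
  then have ex: "\<exists>u\<in>U. x \<in> points_of (u, v u)" for x
    by (auto simp: C_def)
  let ?M = "{(u, v u) | u. u \<in> U}"
  have ex1: "\<exists>!P. P \<in> ?M \<and> x \<in> points_of P" for x
  proof -
    obtain u where u: "u \<in> U" "x \<in> points_of (u, v u)"
      using ex by blast
    show ?thesis
    proof (rule ex1I[of _ "(u, v u)"])
      show "(u, v u) \<in> ?M \<and> x \<in> points_of (u, v u)"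
        using u by blast
      fix P assume "P \<in> ?M \<and> x \<in> points_of P"
      then obtain w where "w \<in> U" "P = (w, v w)" "x \<in> points_of (w, v w)"
        by blast
      then show "P = (u, v u)"
        using unique[OF u(1) \<open>w \<in> U\<close> u(2)] by simp
    qed
  qed
  have fst_fiber: "fst (fiber_through ?M x) = u" if "u \<in> U" "x \<in> points_of (u, v u)" for x u
    using the1_equality[OF ex1[of x], of "(u, v u)"] that by (simp add: fiber_through_def)
  show ?thesis
    unfolding is_fibration_def
  proof (intro conjI allI ballI impI)
    show "?M \<subseteq> affine_oriented_grassmannian"
      using uG vU by (auto simp: affine_oriented_grassmannian_def)
    show "\<exists>!P. P \<in> ?M \<and> x \<in> points_of P" for x
      by (rule ex1)
    show "skew P Q" if "P \<in> ?M" "Q \<in> ?M" "P \<noteq> Q" for P Q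
      using that skew by auto
    show "continuous_map euclidean ?G (\<lambda>x. fst (fiber_through ?M x))"
      unfolding continuous_map_def
    proof (intro conjI allI impI)
      show "(\<lambda>x. fst (fiber_through ?M x)) \<in> topspace euclidean \<rightarrow> topspace ?G"
        using ex fst_fiber uG by fastforce
      fix N assume N: "openin ?G N"
      let ?A = "{x. fst (fiber_through ?M x) \<in> N}"
      have "open ?A"
      proof (subst open_subopen, intro ballI)
        fix x assume "x \<in> ?A"
        moreover obtain u where u: "u \<in> U" "x \<in> points_of (u, v u)"
          using ex by blast
        ultimately have "u \<in> N"
          using fst_fiber by simp
        from nbhd[OF u N this] obtain A where A: "open A" "x \<in> A"
          "\<forall>a\<in>A. \<exists>u\<in>U \<inter> N. a \<in> points_of (u, v u)"
          by blast
        have "A \<subseteq> ?A"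
        proof
          fix a assume "a \<in> A"
          then obtain w where "w \<in> U" "w \<in> N" "a \<in> points_of (w, v w)"
            using A(3) by blast
          then show "a \<in> ?A"
            using fst_fiber by simp
        qed
        then show "\<exists>A. open A \<and> x \<in> A \<and> A \<subseteq> ?A"
          using A by blast
      qed
      then show "openin euclidean {x \<in> topspace euclidean. fst (fiber_through ?M x) \<in> N}"
        by simp
    qed
  qed
qed

text \<open>\<open>U \<noteq> {}\<close> is explicit because the empty space counts as connected and
  contractible here, while an empty set of planes does not cover the space.\<close>

theorem theorem1:
  fixes M :: "((real^'n^'p) set \<times> (real^'n)) set"
    and p n q :: nat
  assumes "p = CARD('p)" and "n = CARD('n)"
    and "1 \<le> p" and "p < n" and "q = n - p"
    and "M \<subseteq> affine_oriented_grassmannian"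
  shows "is_fibration M \<longleftrightarrow>
    (\<exists>(U :: (real^'n^'p) set set) (v :: (real^'n^'p) set \<Rightarrow> real^'n).
       U \<noteq> {} \<and>
       topological_submanifold q oriented_grassmannian U \<and>
       connectedin oriented_grassmannian U \<and>
       contractible_space (subtopology oriented_grassmannian U) \<and>
       xi_section U v \<and>
       M = {(u, v u) | u. u \<in> U} \<and>
       (\<forall>u1\<in>U. \<forall>u2\<in>U. u1 \<noteq> u2 \<longrightarrow>
          dim (span (plane_of u1 \<union> plane_of u2 \<union> {v u1 - v u2})) = 2 * p + 1) \<and>
       (\<forall>s u. (\<forall>k. s k \<in> U) \<and> u \<in> (oriented_grassmannian closure_of U) - U \<and>
          limitin oriented_grassmannian s u sequentially \<longrightarrow>
          filterlim (\<lambda>k::nat. norm (v (s k))) at_top sequentially))"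
    (is "_ \<longleftrightarrow> (\<exists>U v. ?R U v)")
proof
  assume fib: "is_fibration M"
  show "\<exists>U v. ?R U v"
  proof (rule fibration_imp_section[OF fib], intro exI conjI)
    fix U v
    assume man: "topological_submanifold (CARD('n) - CARD('p)) oriented_grassmannian U"
      and M: "M = {(u, v u) | u. u \<in> U}"
      and proper: "\<And>s u. \<lbrakk>\<forall>k. s k \<in> U; u \<in> topspace oriented_grassmannian - U;
        limitin oriented_grassmannian s u sequentially\<rbrakk> \<Longrightarrow>
        filterlim (\<lambda>k. norm (v (s k))) at_top sequentially"
    show "topological_submanifold q oriented_grassmannian U"
      using man assms by simp
    have U: "U \<subseteq> topspace oriented_grassmannian"
      using man by (simp add: topological_submanifold_def)
    show "\<forall>u1\<in>U. \<forall>u2\<in>U. u1 \<noteq> u2 \<longrightarrow>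
        dim (span (plane_of u1 \<union> plane_of u2 \<union> {v u1 - v u2})) = 2 * p + 1"
    proof (intro ballI impI)
      fix u1 u2 assume u: "u1 \<in> U" "u2 \<in> U" "u1 \<noteq> u2"
      have "\<forall>P\<in>M. \<forall>Q\<in>M. P \<noteq> Q \<longrightarrow> skew P Q"
        using fib by (simp add: is_fibration_def)
      moreover have "(u1, v u1) \<in> M" "(u2, v u2) \<in> M"
        using u by (auto simp: M)
      ultimately have "skew (u1, v u1) (u2, v u2)"
        using u(3) by blast
      then show "dim (span (plane_of u1 \<union> plane_of u2 \<union> {v u1 - v u2})) = 2 * p + 1"
        using skew_iff_dim[of u1 u2 "v u1" "v u2"] u U assms(1) by auto
    qed
    show "\<forall>s u. (\<forall>k. s k \<in> U) \<and> u \<in> (oriented_grassmannian closure_of U) - U \<and>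
        limitin oriented_grassmannian s u sequentially \<longrightarrow>
        filterlim (\<lambda>k::nat. norm (v (s k))) at_top sequentially"
    proof (intro allI impI, elim conjE)
      fix s u
      assume s: "\<forall>k. s k \<in> U" "u \<in> (oriented_grassmannian closure_of U) - U"
        and lim: "limitin oriented_grassmannian s u sequentially"
      then have "u \<in> topspace oriented_grassmannian - U"
        using limitin_topspace[OF lim] by simp
      then show "filterlim (\<lambda>k::nat. norm (v (s k))) at_top sequentially"
        by (rule proper[OF s(1) _ lim])
    qed
  qed assumption+
next
  assume "\<exists>U v. ?R U v"
  then show "is_fibration M"
  proof (elim exE conjE)
    fix U v
    assume "U \<noteq> {}" and man: "topological_submanifold q oriented_grassmannian U"
      and sec: "xi_section U v" and M: "M = {(u, v u) | u. u \<in> U}"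
      and dim: "\<forall>u1\<in>U. \<forall>u2\<in>U. u1 \<noteq> u2 \<longrightarrow>
        dim (span (plane_of u1 \<union> plane_of u2 \<union> {v u1 - v u2})) = 2 * p + 1"
      and proper: "\<forall>s u. (\<forall>k. s k \<in> U) \<and> u \<in> (oriented_grassmannian closure_of U) - U \<and>
        limitin oriented_grassmannian s u sequentially \<longrightarrow>
        filterlim (\<lambda>k::nat. norm (v (s k))) at_top sequentially"
    have U: "U \<subseteq> topspace oriented_grassmannian"
      using man by (simp add: topological_submanifold_def)
    show "is_fibration M"
      unfolding M
    proof (rule section_imp_fibration[OF \<open>U \<noteq> {}\<close> _ sec])
      show "topological_submanifold (CARD('n) - CARD('p)) oriented_grassmannian U"
        using man assms by simp
      show "skew (u, v u) (w, v w)" if "u \<in> U" "w \<in> U" "u \<noteq> w" for u w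
      proof -
        have "dim (span (plane_of u \<union> plane_of w \<union> {v u - v w})) = 2 * CARD('p) + 1"
          using dim that assms(1) by blast
        then show ?thesis
          using skew_iff_dim[of u w] that U by blast
      qed
      show "filterlim (\<lambda>k. norm (v (s k))) at_top sequentially"
        if "\<forall>k. s k \<in> U" "u \<in> (oriented_grassmannian closure_of U) - U"
          "limitin oriented_grassmannian s u sequentially" for s u
        using proper that by blast
    qed
  qed
qed

end
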